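(* Let $n\ge 1$ and let $(f_{ij})_{0\le j\le i\le n-1}$ be the $f$-triangle of $\Delta_{\mathrm{Dyck}_n}$. Then \[ f_{ij}=\Big|\bigl\{\,w\in\mathrm{Dyck}_n : |V(w)|=j\text{ and }\mu(w)=i\,\bigr\}\Big|,\qquad 0\le j\le i\le n-1 . \]
   Context: A Dyck path of semilength $n$ is a word $w=w_1\cdots w_{2n}$ in $\{U,D\}$ with equally many $U$'s and $D$'s such that every prefix contains at least as many $U$'s as $D$'s; $\mathrm{Dyck}_n$ is the set of these. A valley of $w$ is an index $i$ with $w_i=D$, $w_{i+1}=U$, identified with its position $(i,y)$, where $y$ is the number of $U$'s minus the number of $D$'s in $w_1\cdots w_i$. $V(w)$ is the set of valley positions of $w$, and $\Delta_{\mathrm{Dyck}_n}=\{V(w):w\in\mathrm{Dyck}_n\}$, which is a simplicial complex of dimension $n-2$. For $w\in\mathrm{Dyck}_n$ with valleys $p_1,\ldots,p_\ell$ listed from left to right, let $p_0=(0,0)$ be the starting point and $p_{\ell+1}=(2n,0)$ the terminal point of $w$. For $1\le i\le\ell+1$ let $u_i$ and $d_i$ be the numbers of $U$-steps and $D$-steps in the portion of $w$ from $p_{i-1}$ to $p_i$. Define $\mu(w)=\Bigl(\sum_{i=1}^{\ell+1}\min\{u_i,d_i\}\Bigr)-1$. For a simplicial complex $\Delta$, the degree of a face $\sigma$ is $\deg(\sigma)=\max\{|\tau| : \tau\in\Delta,\ \sigma\subseteq\tau\}$. The $f$-triangle of $\Delta$ is the array $(f_{ij})$ where $f_{ij}$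 is the number of faces $\sigma$ with $|\sigma|=j$ and $\deg(\sigma)=i$. *)

theory Defs
  imports Main
begin

datatype step = U | D

definition Dyck :: "nat \<Rightarrow> step list set" where
  "Dyck n = {w. length w = 2 * n \<and> count_list w U = count_list w D \<and>
     (\<forall>k \<le> length w. count_list (take k w) D \<le> count_list (take k w) U)}"

text \<open>The valley indices follow the convention \<open>w = w\<^sub>1 \<dots> w\<^sub>2\<^sub>n\<close>,
  so the letter \<open>w\<^sub>i\<close> is \<open>w ! (i - 1)\<close>.\<close>

definition is_valley :: "step list \<Rightarrow> nat \<Rightarrow> bool" where
  "is_valley w i \<longleftrightarrow> 1 \<le> i \<and> i < length w \<and> w ! (i - 1) = D \<and> w ! i = U"

definition height :: "step list \<Rightarrow> nat \<Rightarrow> int" where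
  "height w i = int (count_list (take i w) U) - int (count_list (take i w) D)"

definition valleys :: "step list \<Rightarrow> (nat \<times> int) set" where
  "valleys w = {(i, height w i) | i. is_valley w i}"

definition Delta_Dyck :: "nat \<Rightarrow> (nat \<times> int) set set" where
  "Delta_Dyck n = valleys ` Dyck n"

text \<open>\<open>cuts w\<close> lists the first coordinates of the points
  \<open>p\<^sub>0, p\<^sub>1, \<dots>, p\<^sub>\<ell>, p\<^sub>\<ell>\<^sub>+\<^sub>1\<close>, that is, of the starting point, the valleys from
  left to right, and the terminal point. The first coordinate of a point on the path is the
  number of letters preceding it, so \<open>portion w i\<close> is the part of \<open>w\<close> from
  \<open>p\<^sub>i\<^sub>-\<^sub>1\<close> to \<open>p\<^sub>i\<close>, for \<open>1 \<le> i \<le> \<ell> + 1\<close>.\<close>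

definition cuts :: "step list \<Rightarrow> nat list" where
  "cuts w = 0 # sorted_list_of_set {i. is_valley w i} @ [length w]"

definition portion :: "step list \<Rightarrow> nat \<Rightarrow> step list" where
  "portion w i = drop (cuts w ! (i - 1)) (take (cuts w ! i) w)"

definition mu :: "step list \<Rightarrow> int" where
  "mu w = (\<Sum>i = 1..card (valleys w) + 1.
     int (min (count_list (portion w i) U) (count_list (portion w i) D))) - 1"

text \<open>A simplicial complex is represented by its set of faces. The maximum is meaningful
  for a face of a complex whose face sizes are bounded, such as \<open>Delta_Dyck n\<close>.\<close>

definition face_degree :: "'a set set \<Rightarrow> 'a set \<Rightarrow> nat" where
  "face_degree \<Delta> \<sigma> = Max {card \<tau> | \<tau>. \<tau> \<in> \<Delta> \<and> \<sigma> \<subseteq> \<tau>}"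

definition f_triangle :: "'a set set \<Rightarrow> nat \<Rightarrow> nat \<Rightarrow> nat" where
  "f_triangle \<Delta> i j = card {\<sigma> \<in> \<Delta>. card \<sigma> = j \<and> face_degree \<Delta> \<sigma> = i}"

end

theory Submission
  imports Defs "HOL-Library.Product_Plus"
begin

text \<open>A nonempty Dyck path is a sequence of blocks \<open>U\<^sup>u D\<^sup>d\<close> with \<open>u, d \<ge> 1\<close>, and its valleys are
  the junctions of consecutive blocks. So a path is determined by its valleys, and
  \<open>valleys w \<subseteq> valleys w'\<close> means that the blocks of \<open>w'\<close> refine those of \<open>w\<close>. A block
  \<open>(u, d)\<close> splits into at most \<open>min u d\<close> positive pieces, and this is attained by splitting off
  pieces \<open>(1, 1)\<close> at its end: the resulting valleys all have the end height of the block, so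
  that the path remains a Dyck path. Hence the degree of the face \<open>valleys w\<close> is \<open>mu w\<close>.\<close>

section \<open>Block words\<close>

definition block :: "nat \<times> nat \<Rightarrow> step list" where
  "block b = replicate (fst b) U @ replicate (snd b) D"

definition word :: "(nat \<times> nat) list \<Rightarrow> step list" where
  "word bs = concat (map block bs)"

definition positive :: "(nat \<times> nat) list \<Rightarrow> bool" where
  "positive bs \<longleftrightarrow> (\<forall>(u, d) \<in> set bs. 0 < u \<and> 0 < d)"

text \<open>These are the sums of the nonempty prefixes. For a block list they are the pairs of step
  counts at the block ends, the terminal point included.\<close>

fun partial_sums :: "'a::monoid_add list \<Rightarrow> 'a set" where
  "partial_sums [] = {}"
| "partial_sums (b # bs) = insert b ((+) b ` partial_sums bs)"

lemma positive_simps [simp]: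
  "positive []"
  "positive (b # bs) \<longleftrightarrow> 0 < fst b \<and> 0 < snd b \<and> positive bs"
  "positive (bs @ cs) \<longleftrightarrow> positive bs \<and> positive cs"
  by (auto simp: positive_def)

lemma word_simps [simp]:
  "word [] = []"
  "word (b # bs) = block b @ word bs"
  "word (bs @ cs) = word bs @ word cs"
  by (auto simp: word_def)

lemma count_list_replicate: "count_list (replicate m x) y = (if x = y then m else 0)"
  by (induction m) auto

lemma count_list_block [simp]:
  "count_list (block b) U = fst b" "count_list (block b) D = snd b"
  by (simp_all add: block_def count_list_replicate)

lemma length_block [simp]: "length (block b) = fst b + snd b"
  by (simp add: block_def)

lemma count_list_word:
  "count_list (word bs) U = fst (sum_list bs)" "count_list (word bs) D = snd (sum_list bs)"
  by (induction bs) auto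

lemma word_positive_nonempty:
  assumes "positive bs" "bs \<noteq> []"
  shows "word bs \<noteq> []" "hd (word bs) = U"
proof -
  obtain u d cs where "bs = (u, d) # cs" using assms(2) by (metis list.exhaust surj_pair)
  then show "word bs \<noteq> []" "hd (word bs) = U" using assms(1)
    by (auto simp: block_def hd_append)
qed

text \<open>The induction strips the first letter, and what remains may start in the middle of a
  descent; hence the extra leading run of \<open>D\<close>.\<close>

lemma word_decomposition_aux:
  "w = [] \<or> last w = D \<Longrightarrow> \<exists>d bs. positive bs \<and> w = replicate d D @ word bs"
proof (induction w)
  case Nil
  then show ?case by (intro exI[of _ 0] exI[of _ "[]"]) simp
next
  case (Cons a w)
  then have "w = [] \<or> last w = D" by (auto split: if_splits)
  then obtain d bs where w: "positive bs" "w = replicate d D @ word bs" using Cons.IH by blast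
  show ?case
  proof (cases a)
    case D
    then show ?thesis using w by (intro exI[of _ "Suc d"] exI[of _ bs]) simp
  next
    case U
    then have "w \<noteq> []" using Cons.prems by auto
    show ?thesis
    \<comment> \<open>A new leading \<open>U\<close> lengthens the first block if no
      \<open>D\<close> precedes it, and otherwise forms the block \<open>(1, d)\<close> with the
      leading run.\<close>
    proof (cases "d = 0")
      case True
      then obtain u e cs where "bs = (u, e) # cs"
        using w \<open>w \<noteq> []\<close> by (metis append_Nil list.exhaust replicate_0 surj_pair word_simps(1))
      then show ?thesis using U w True
        by (intro exI[of _ 0] exI[of _ "(Suc u, e) # cs"]) (simp add: block_def)
    next
      case False
      then show ?thesis using U w
        by (intro exI[of _ 0] exI[of _ "(1, d) # bs"]) (simp add: block_def)
    qed
  qed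
qed

lemma word_decomposition:
  assumes "w \<noteq> []" "hd w = U" "last w = D"
  obtains bs where "positive bs" "bs \<noteq> []" "w = word bs"
proof -
  obtain d bs where w: "positive bs" "w = replicate d D @ word bs"
    using word_decomposition_aux assms by blast
  have "d = 0" using w assms(2) by (cases d) auto
  with w assms(1) show ?thesis by (intro that[of bs]) auto
qed

section \<open>Valleys of block words\<close>

lemma height_append:
  "height (x @ y) (length x + i) = int (count_list x U) - int (count_list x D) + height y i"
  by (simp add: height_def)

lemma is_valley_append:
  "is_valley (x @ y) i \<longleftrightarrow> is_valley x i \<or>
     (i = length x \<and> x \<noteq> [] \<and> y \<noteq> [] \<and> last x = D \<and> hd y = U) \<or>
     (length x < i \<and> is_valley y (i - length x))"
proof (cases i "length x" rule: linorder_cases)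
  case less
  then show ?thesis by (auto simp: is_valley_def nth_append)
next
  case equal
  then show ?thesis
    by (cases "x = []"; cases "y = []")
      (auto simp: is_valley_def nth_append last_conv_nth hd_conv_nth Suc_le_eq)
next
  case greater
  then show ?thesis
    by (auto simp: is_valley_def nth_append Suc_le_eq less_diff_conv2 add.commute
        diff_commute)
qed

lemma not_is_valley_block: "\<not> is_valley (block b) i"
  by (auto simp: is_valley_def block_def nth_append split: if_splits)

abbreviation valley_indices :: "step list \<Rightarrow> nat set" where
  "valley_indices w \<equiv> {i. is_valley w i}"

lemma finite_valley_indices: "finite (valley_indices w)"
  by (rule finite_subset[of _ "{..<length w}"]) (auto simp: is_valley_def)

lemma valleys_eq: "valleys w = (\<lambda>i. (i, height w i)) ` valley_indices w"
  by (auto simp: valleys_def)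

lemma card_valleys: "card (valleys w) = card (valley_indices w)"
  unfolding valleys_eq by (rule card_image) (auto simp: inj_on_def)

lemma valley_indices_block: "valley_indices (block b) = {}"
  by (simp add: not_is_valley_block)

lemma valley_indices_word_Cons:
  assumes "positive (b # bs)" "bs \<noteq> []"
  shows "valley_indices (word (b # bs)) =
    insert (fst b + snd b) ((+) (fst b + snd b) ` valley_indices (word bs))"
proof -
  obtain u d where b: "b = (u, d)" by fastforce
  have block: "block b \<noteq> []" "last (block b) = D" using assms(1) by (auto simp: block_def)
  \<comment> \<open>Valleys of \<open>word bs\<close> have positive index, so after the shift they
    lie strictly beyond the junction \<open>u + d\<close>.\<close>
  have *: "is_valley (word bs) i \<Longrightarrow> 0 < i" for i by (simp add: is_valley_def)
  have "valley_indices (word (b # bs)) =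
    {i. i = u + d \<or> u + d < i \<and> is_valley (word bs) (i - (u + d))}"
    using assms block word_positive_nonempty[of bs] not_is_valley_block
    by (auto simp: is_valley_append b)
  also have "\<dots> = insert (u + d) ((+) (u + d) ` valley_indices (word bs))"
    using * by (force intro: image_eqI[of _ _ "_ - (u + d)"])
  finally show ?thesis by (simp add: b)
qed

text \<open>Change of coordinates from the numbers of \<open>U\<close> and \<open>D\<close> steps to
  index and height. Being injective, it turns inclusions of valley sets into inclusions of sets of
  partial sums.\<close>

definition to_point :: "nat \<times> nat \<Rightarrow> nat \<times> int" where
  "to_point p = (fst p + snd p, int (fst p) - int (snd p))"

lemma inj_to_point: "inj to_point"
  by (auto simp: inj_def to_point_def)

lemma partial_sums_positive:
  assumes "positive bs" "p \<in> partial_sums bs"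
  shows "0 < fst p" "0 < snd p"
  using assms by (induction bs arbitrary: p) auto

lemma partial_sums_le:
  assumes "p \<in> partial_sums bs"
  shows "fst p \<le> fst (sum_list bs :: nat \<times> nat)" "snd p \<le> snd (sum_list bs)"
  using assms by (induction bs arbitrary: p) auto

lemma partial_sums_append:
  "partial_sums (bs @ cs) = partial_sums bs \<union> (+) (sum_list bs) ` partial_sums cs"
  by (induction bs) (auto simp: image_Un image_image add.assoc)

lemma sum_list_in_partial_sums: "bs \<noteq> [] \<Longrightarrow> sum_list bs \<in> partial_sums bs"
proof (induction bs)
  case (Cons b bs)
  then show ?case by (cases "bs = []") auto
qed simp

lemma partial_sums_split:
  assumes "p \<in> partial_sums bs"
  obtains xs ys where "bs = xs @ ys" "sum_list xs = p"
  using assms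
proof (induction bs arbitrary: p thesis)
  case Nil
  then show ?case by simp
next
  case (Cons b bs)
  show ?case
  proof (cases "p = b")
    case True
    then show ?thesis using Cons.prems(1)[of "[b]" bs] by simp
  next
    case False
    then obtain q where q: "q \<in> partial_sums bs" "p = b + q" using Cons.prems(2) by auto
    obtain xs ys where "bs = xs @ ys" "sum_list xs = q" using Cons.IH[OF _ q(1)] by blast
    then show ?thesis using Cons.prems(1)[of "b # xs" ys] q by simp
  qed
qed

text \<open>Every block ends in \<open>D\<close> and the next one starts with \<open>U\<close>, so
  each block end is a valley, except the last, which is the terminal point; hence the removal of the
  total.\<close>

lemma valleys_word:
  assumes "positive bs" "bs \<noteq> []"
  shows "valleys (word bs) = to_point ` (partial_sums bs - {sum_list bs})"
  using assms
proof (induction bs)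
  case Nil
  then show ?case by simp
next
  case (Cons b bs)
  show ?case
  proof (cases "bs = []")
    case True
    then show ?thesis by (simp add: valleys_eq not_is_valley_block)
  next
    case False
    let ?N = "fst b + snd b"
    \<comment> \<open>The first block end is not the total, so removing the total affects only the
      shifted part.\<close>
    have b: "b \<noteq> b + sum_list bs"
      using partial_sums_positive(1)[OF _ sum_list_in_partial_sums[OF False]] Cons.prems(1)
      by (auto simp: prod_eq_iff)
    have "valleys (word (b # bs)) =
      (\<lambda>i. (i, height (block b @ word bs) i)) ` insert ?N ((+) ?N ` valley_indices (word bs))"
      using valley_indices_word_Cons[OF Cons.prems(1) False] by (simp add: valleys_eq)
    also have "\<dots> = insert (to_point b)
      ((\<lambda>(i, h). (?N + i, int (fst b) - int (snd b) + h)) ` valleys (word bs))"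
      using height_append[of "block b" "word bs"] height_append[of "block b" "word bs" 0]
      by (simp add: valleys_eq image_image to_point_def height_def[of _ 0])
    also have "\<dots> = insert (to_point b)
      ((\<lambda>p. to_point (b + p)) ` (partial_sums bs - {sum_list bs}))"
      using Cons.IH Cons.prems False
      by (simp add: image_image to_point_def algebra_simps)
    also have "\<dots> = to_point ` (partial_sums (b # bs) - {sum_list (b # bs)})"
      using b by (auto simp: image_iff)
    finally show ?thesis .
  qed
qed

text \<open>Positivity makes the partial sums strictly increasing, hence distinct.\<close>

lemma card_partial_sums:
  assumes "positive bs"
  shows "finite (partial_sums bs) \<and> card (partial_sums bs) = length bs"
  using assms
proof (induction bs)
  case Nil
  then show ?case by simp
next
  case (Cons b bs)
  then have IH: "finite (partial_sums bs)" "card (partial_sums bs) = length bs" by auto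
  have "b \<notin> (+) b ` partial_sums bs"
    using partial_sums_positive(1)[of bs] Cons.prems by (force simp: prod_eq_iff)
  moreover have "inj_on ((+) b) (partial_sums bs)" by (simp add: inj_on_def)
  ultimately show ?case using IH by (simp add: card_image)
qed

lemma card_valleys_word:
  assumes "positive bs" "bs \<noteq> []"
  shows "card (valleys (word bs)) = length bs - 1"
proof -
  have "card (valleys (word bs)) = card (partial_sums bs - {sum_list bs})"
    unfolding valleys_word[OF assms] by (rule card_image) (rule inj_on_subset[OF inj_to_point], simp)
  then show ?thesis
    using card_partial_sums[OF assms(1)] sum_list_in_partial_sums[OF assms(2)] by simp
qed

text \<open>The common total belongs to both sets of partial sums and is the one element left out of
  both valley sets, so putting it back preserves the inclusion.\<close>

lemma valleys_word_subset_iff: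
  assumes "positive bs" "bs \<noteq> []" "positive cs" "cs \<noteq> []" "sum_list bs = sum_list cs"
  shows "valleys (word bs) \<subseteq> valleys (word cs) \<longleftrightarrow> partial_sums bs \<subseteq> partial_sums cs"
  using assms sum_list_in_partial_sums[of bs] sum_list_in_partial_sums[of cs]
  by (auto simp: valleys_word inj_image_subset_iff[OF inj_to_point])

text \<open>The head of a positive list is the partial sum with the least first coordinate: two
  different heads would each lie strictly beyond the other. Cancelling the head leaves the
  tails.\<close>

lemma partial_sums_inject:
  assumes "positive bs" "positive cs" "partial_sums bs = partial_sums cs"
  shows "bs = cs"
  using assms
proof (induction bs arbitrary: cs)
  case Nil
  then show ?case by (cases cs) auto
next
  case (Cons b bs)
  then obtain c ds where cs: "cs = c # ds" by (cases cs) auto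
  have pos: "\<forall>p \<in> partial_sums bs. 0 < fst p" "\<forall>p \<in> partial_sums ds. 0 < fst p"
    using partial_sums_positive(1) Cons.prems cs by auto
  have eq: "insert b ((+) b ` partial_sums bs) = insert c ((+) c ` partial_sums ds)"
    using Cons.prems cs by simp
  have "b = c"
  proof (rule ccontr)
    assume "b \<noteq> c"
    then have "b \<in> (+) c ` partial_sums ds" "c \<in> (+) b ` partial_sums bs"
      using eq by (metis insertE insertI1)+
    then show False using pos by (auto simp: prod_eq_iff)
  qed
  have "b \<notin> (+) b ` partial_sums bs" "b \<notin> (+) b ` partial_sums ds"
    using pos by (auto simp: prod_eq_iff)
  then have "(+) b ` partial_sums bs = (+) b ` partial_sums ds"
    using eq \<open>b = c\<close> by (metis insert_ident)
  then have "partial_sums bs = partial_sums ds" by (simp add: inj_image_eq_iff)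
  then show ?case using Cons cs \<open>b = c\<close> by simp
qed

section \<open>The statistic of a block word\<close>

abbreviation min_sum :: "(nat \<times> nat) list \<Rightarrow> nat" where
  "min_sum bs \<equiv> \<Sum>b\<leftarrow>bs. min (fst b) (snd b)"

lemma sorted_list_of_set_insert_shift:
  fixes A :: "nat set"
  assumes "finite A" "0 \<notin> A"
  shows "sorted_list_of_set (insert N ((+) N ` A)) = N # map ((+) N) (sorted_list_of_set A)"
proof -
  have "sorted_wrt (<) (N # map ((+) N) (sorted_list_of_set A))"
    using assms by (auto simp: sorted_wrt_map intro: gr0I)
  moreover have "set (N # map ((+) N) (sorted_list_of_set A)) = insert N ((+) N ` A)"
    using assms by simp
  ultimately show ?thesis
    by (metis sorted_list_of_set.idem_if_sorted_distinct strict_sorted_iff)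
qed

text \<open>The leading \<open>0\<close> of \<open>cuts (word bs)\<close> is shifted to the new
  valley at the junction, and its last entry to the new length.\<close>

lemma cuts_word_Cons:
  assumes "positive (b # bs)" "bs \<noteq> []"
  shows "cuts (word (b # bs)) = 0 # map ((+) (fst b + snd b)) (cuts (word bs))"
proof -
  have "0 \<notin> valley_indices (word bs)" by (simp add: is_valley_def)
  from sorted_list_of_set_insert_shift[OF finite_valley_indices this]
  show ?thesis
    unfolding cuts_def valley_indices_word_Cons[OF assms] by simp
qed

lemma length_cuts: "length (cuts w) = card (valleys w) + 2"
  by (simp add: cuts_def card_valleys)

text \<open>The portions between consecutive cuts are exactly the blocks.\<close>

lemma mu_word:
  assumes "positive bs" "bs \<noteq> []"
  shows "mu (word bs) = int (min_sum bs) - 1"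
  using assms
proof (induction bs)
  case Nil
  then show ?case by simp
next
  case (Cons b bs)
  show ?case
  proof (cases "bs = []")
    case True
    then show ?thesis
      by (simp add: mu_def portion_def cuts_def card_valleys valley_indices_block)
  next
    case False
    let ?w = "word bs" and ?w' = "word (b # bs)"
    define f where "f v = int (min (count_list v U) (count_list v D))" for v
    have card: "card (valleys ?w') = Suc (card (valleys ?w))"
      using card_valleys_word[OF Cons.prems] card_valleys_word[of bs] Cons.prems False
      by (cases bs) auto
    have cuts: "cuts ?w' = 0 # map ((+) (fst b + snd b)) (cuts ?w)"
      by (rule cuts_word_Cons) (use Cons.prems False in auto)
    have first: "portion ?w' 1 = block b"
      using cuts by (simp add: portion_def) (simp add: cuts_def)
    have rest: "portion ?w' (Suc i) = portion ?w i" if "i \<in> {1..card (valleys ?w) + 1}" for i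
    proof -
      \<comment> \<open>Writing \<open>i\<close> as a successor resolves the truncated
        \<open>i - 1\<close> in \<open>portion\<close>; both cuts are then shifted by the length of
        the first block, which \<open>drop\<close> and \<open>take\<close> cancel.\<close>
      obtain k where "i = Suc k" "Suc k < length (cuts ?w)"
        using \<open>i \<in> _\<close> length_cuts[of ?w] by (cases i) auto
      then show ?thesis by (simp add: portion_def cuts[simplified])
    qed
    have "mu ?w' = (\<Sum>i = 1..Suc (card (valleys ?w) + 1). f (portion ?w' i)) - 1"
      by (simp only: mu_def f_def card add_Suc)
    also have "\<dots> = f (portion ?w' 1) + (\<Sum>i = 1..card (valleys ?w) + 1. f (portion ?w' (Suc i))) - 1"
      by (subst sum.atLeast_Suc_atMost)
        (simp, simp only: sum.shift_bounds_cl_Suc_ivl One_nat_def)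
    also have "\<dots> = f (block b) + (mu ?w + 1) - 1"
      using rest by (simp add: first[simplified] mu_def f_def)
    finally show ?thesis using Cons.IH Cons.prems False by (simp add: f_def)
  qed
qed

section \<open>Refinements\<close>

lemma length_le_sum_list:
  assumes "positive bs"
  shows "length bs \<le> min (fst (sum_list bs)) (snd (sum_list bs))"
  using assms by (induction bs) auto

text \<open>The upper bound for degrees. The inclusion cuts \<open>cs\<close> into consecutive
  groups summing to the entries of \<open>bs\<close>, and each positive piece in the group of
  \<open>b\<close> uses at least one step of either kind.\<close>

lemma length_refinement_le:
  assumes "positive bs" "positive cs" "sum_list bs = sum_list cs"
    and "partial_sums bs \<subseteq> partial_sums cs"
  shows "length cs \<le> min_sum bs"
  using assms
proof (induction bs arbitrary: cs)
  case Nil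
  then show ?case using length_le_sum_list[of cs] by (simp flip: Nil.prems(3))
next
  case (Cons b bs)
  then obtain xs ys where cs: "cs = xs @ ys" and b: "sum_list xs = b"
    by (metis insertCI partial_sums.simps(2) partial_sums_split subset_eq)
  have "partial_sums bs \<subseteq> partial_sums ys"
  proof
    fix p assume p: "p \<in> partial_sums bs"
    then have "b + p \<in> partial_sums xs \<union> (+) b ` partial_sums ys"
      using Cons.prems(4) by (auto simp: cs b partial_sums_append)
    \<comment> \<open>Partial sums of \<open>xs\<close> have first coordinate at most that of
      \<open>b\<close>, while \<open>p\<close> adds a positive amount.\<close>
    moreover have "b + p \<notin> partial_sums xs"
      using partial_sums_le(1)[of "b + p" xs] partial_sums_positive(1)[OF _ p] Cons.prems(1) b
      by auto
    ultimately show "p \<in> partial_sums ys" by auto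
  qed
  moreover have "sum_list bs = sum_list ys" using Cons.prems(3) by (simp add: cs b)
  ultimately have "length ys \<le> min_sum bs" using Cons.IH[of ys] Cons.prems by (simp add: cs)
  moreover have "length xs \<le> min (fst b) (snd b)"
    using length_le_sum_list[of xs] Cons.prems by (simp add: cs b)
  ultimately show ?case unfolding cs length_append list.map sum_list.Cons by linarith
qed

text \<open>The Dyck prefix condition for a path starting at height \<open>h\<close>. With
  \<open>h\<close> as a parameter it splits along concatenation and can be checked block by
  block.\<close>

fun nonneg :: "int \<Rightarrow> step list \<Rightarrow> bool" where
  "nonneg h [] \<longleftrightarrow> 0 \<le> h"
| "nonneg h (U # w) \<longleftrightarrow> 0 \<le> h \<and> nonneg (h + 1) w"
| "nonneg h (D # w) \<longleftrightarrow> 0 \<le> h \<and> nonneg (h - 1) w"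

lemma nonneg_start: "nonneg h w \<Longrightarrow> 0 \<le> h"
  by (cases "(h, w)" rule: nonneg.cases) auto

lemma nonneg_iff:
  "nonneg h w \<longleftrightarrow>
    (\<forall>k \<le> length w. int (count_list (take k w) D) \<le> h + int (count_list (take k w) U))"
proof (induction h w rule: nonneg.induct)
  case (1 h)
  then show ?case by simp
next
  case (2 h w)
  have "(\<forall>k \<le> length (U # w). P k) \<longleftrightarrow> P 0 \<and> (\<forall>k \<le> length w. P (Suc k))" for P
    by (auto simp: less_Suc_eq_0_disj simp flip: less_Suc_eq_le)
  then show ?case using 2 by (simp add: algebra_simps)
next
  case (3 h w)
  have "(\<forall>k \<le> length (D # w). P k) \<longleftrightarrow> P 0 \<and> (\<forall>k \<le> length w. P (Suc k))" for P
    by (auto simp: less_Suc_eq_0_disj simp flip: less_Suc_eq_le)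
  then show ?case using 3 by (simp add: algebra_simps)
qed

lemma nonneg_append:
  "nonneg h (x @ y) \<longleftrightarrow>
    nonneg h x \<and> nonneg (h + int (count_list x U) - int (count_list x D)) y"
  by (induction h x rule: nonneg.induct) (auto simp: algebra_simps dest: nonneg_start)

lemma nonneg_replicate_U: "nonneg h (replicate u U) \<longleftrightarrow> 0 \<le> h"
proof (induction u arbitrary: h)
  case (Suc u)
  show ?case unfolding replicate_Suc nonneg.simps Suc by linarith
qed simp

lemma nonneg_replicate_D: "nonneg h (replicate d D) \<longleftrightarrow> 0 \<le> h - int d"
proof (induction d arbitrary: h)
  case (Suc d)
  show ?case unfolding replicate_Suc nonneg.simps Suc by (simp; linarith)
qed simp

text \<open>A block rises and then falls, so its lowest point is one of its ends.\<close>

lemma nonneg_block: "nonneg h (block b) \<longleftrightarrow> 0 \<le> h \<and> 0 \<le> h + int (fst b) - int (snd b)"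
  by (auto simp: block_def nonneg_append nonneg_replicate_U nonneg_replicate_D count_list_replicate)

lemma Dyck_iff:
  "w \<in> Dyck n \<longleftrightarrow> count_list w U = n \<and> count_list w D = n \<and> nonneg 0 w"
proof -
  have "length w = count_list w U + count_list w D"
    by (induction w) (auto, metis step.exhaust)
  then show ?thesis by (auto simp: Dyck_def nonneg_iff)
qed

lemma word_Dyck_iff: "word bs \<in> Dyck n \<longleftrightarrow> sum_list bs = (n, n) \<and> nonneg 0 (word bs)"
  by (auto simp: Dyck_iff count_list_word prod_eq_iff)

text \<open>A first step \<open>D\<close> would lead to height -1, and a last step \<open>U\<close>
  to height 0 would start there.\<close>

lemma Dyck_decomposition:
  assumes "w \<in> Dyck n" "1 \<le> n"
  obtains bs where "positive bs" "bs \<noteq> []" "w = word bs"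
proof -
  have w: "count_list w U = n" "count_list w D = n" "nonneg 0 w"
    using assms(1) by (auto simp: Dyck_iff)
  have ne: "w \<noteq> []" using w assms(2) by auto
  have "hd w = U"
  proof (rule ccontr)
    assume "hd w \<noteq> U"
    then obtain v where "w = D # v" using ne by (metis list.collapse step.exhaust)
    then show False using w(3) nonneg_start by fastforce
  qed
  moreover have "last w = D"
  proof (rule ccontr)
    assume "last w \<noteq> D"
    then obtain v where v: "w = v @ [U]"
      using ne by (metis append_butlast_last_id step.exhaust)
    then show False using w by (auto simp: nonneg_append)
  qed
  ultimately show ?thesis using word_decomposition ne that by blast
qed

text \<open>The number \<open>k\<close> of unit pieces is one less than the minimum, so that the
  first piece of a positive block stays positive. If a coordinate is 0, truncated subtraction gives
  \<open>k = 0\<close> and leaves the block unsplit.\<close>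

definition refine :: "nat \<times> nat \<Rightarrow> (nat \<times> nat) list" where
  "refine b = (let k = min (fst b) (snd b) - 1 in
    (fst b - k, snd b - k) # replicate k (1, 1))"

abbreviation refine_all :: "(nat \<times> nat) list \<Rightarrow> (nat \<times> nat) list" where
  "refine_all bs \<equiv> concat (map refine bs)"

lemma sum_list_replicate_ones: "sum_list (replicate k (1, 1)) = (k, k :: nat)"
  by (induction k) (simp_all add: zero_prod_def)

lemma positive_refine:
  assumes "0 < fst b" "0 < snd b"
  shows "positive (refine b)"
  using assms by (auto simp: refine_def Let_def positive_def)

lemma sum_list_refine: "sum_list (refine b) = b"
  by (simp add: refine_def Let_def sum_list_replicate_ones prod_eq_iff
      del: sum_list_replicate One_nat_def)

lemma length_refine:
  assumes "0 < fst b" "0 < snd b"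
  shows "length (refine b) = min (fst b) (snd b)"
  using assms by (auto simp: refine_def Let_def)

lemma nonneg_word_ones: "0 \<le> h \<Longrightarrow> nonneg h (word (replicate k (1, 1)))"
  by (induction k) (auto simp: nonneg_append nonneg_block)

text \<open>Subtracting \<open>k\<close> from both coordinates keeps their difference, so the first
  piece already reaches the end height of the block, where the unit peaks then start.\<close>

lemma nonneg_word_refine:
  assumes "nonneg h (block b)"
  shows "nonneg h (word (refine b))"
  using assms
  by (auto simp: refine_def Let_def nonneg_append nonneg_block
      simp del: One_nat_def intro!: nonneg_word_ones)

lemma positive_refine_all: "positive bs \<Longrightarrow> positive (refine_all bs)"
  by (induction bs) (auto intro: positive_refine)

lemma sum_list_refine_all: "sum_list (refine_all bs) = sum_list bs"
  by (induction bs) (auto simp: sum_list_refine)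

lemma length_refine_all: "positive bs \<Longrightarrow> length (refine_all bs) = min_sum bs"
  by (induction bs) (auto simp: length_refine)

lemma nonneg_word_refine_all: "nonneg h (word bs) \<Longrightarrow> nonneg h (word (refine_all bs))"
  by (induction bs arbitrary: h)
    (auto simp: nonneg_append nonneg_word_refine count_list_word sum_list_refine)

lemma refine_nonempty: "refine b \<noteq> []"
  by (simp add: refine_def Let_def)

text \<open>Each \<open>refine b\<close> sums to \<open>b\<close>, so the old block ends remain
  block ends.\<close>

lemma partial_sums_refine_all: "partial_sums bs \<subseteq> partial_sums (refine_all bs)"
proof (induction bs)
  case Nil
  then show ?case by simp
next
  case (Cons b bs)
  then show ?case
    using sum_list_in_partial_sums[OF refine_nonempty, of b]
    by (auto simp: partial_sums_append sum_list_refine)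
qed

section \<open>Degrees of faces\<close>

lemma inj_on_valleys_Dyck:
  assumes "1 \<le> n"
  shows "inj_on valleys (Dyck n)"
proof (rule inj_onI)
  fix w w' assume w: "w \<in> Dyck n" "w' \<in> Dyck n" and eq: "valleys w = valleys w'"
  obtain bs where bs: "positive bs" "bs \<noteq> []" "w = word bs"
    using Dyck_decomposition[OF w(1) assms] .
  obtain cs where cs: "positive cs" "cs \<noteq> []" "w' = word cs"
    using Dyck_decomposition[OF w(2) assms] .
  have "sum_list bs = sum_list cs" using w bs cs by (simp add: word_Dyck_iff)
  then have "partial_sums bs = partial_sums cs"
    using valleys_word_subset_iff[of bs cs] valleys_word_subset_iff[of cs bs] bs cs eq by simp
  then show "w = w'" using partial_sums_inject bs cs by blast
qed

lemma face_degree_valleys: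
  assumes "w \<in> Dyck n" "1 \<le> n"
  shows "int (face_degree (Delta_Dyck n) (valleys w)) = mu w"
proof -
  obtain bs where bs: "positive bs" "bs \<noteq> []" "w = word bs"
    using Dyck_decomposition[OF assms] .
  have sum: "sum_list bs = (n, n)" using assms(1) bs by (simp add: word_Dyck_iff)
  define S where "S = {card \<tau> | \<tau>. \<tau> \<in> Delta_Dyck n \<and> valleys w \<subseteq> \<tau>}"
  \<comment> \<open>A path has one valley fewer than blocks, so the bound on the number of blocks
    drops by one.\<close>
  have upper: "k \<le> min_sum bs - 1" if k: "k \<in> S" for k
  proof -
    obtain v where v: "v \<in> Dyck n" "valleys w \<subseteq> valleys v" "k = card (valleys v)"
      using k unfolding S_def Delta_Dyck_def by blast
    obtain cs where cs: "positive cs" "cs \<noteq> []" "v = word cs"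
      using Dyck_decomposition[OF v(1) assms(2)] .
    have eq: "sum_list bs = sum_list cs" using v(1) cs sum by (simp add: word_Dyck_iff)
    then have "partial_sums bs \<subseteq> partial_sums cs"
      using valleys_word_subset_iff[of bs cs] bs cs v(2) by simp
    then have "length cs \<le> min_sum bs" using length_refinement_le bs(1) cs(1) eq by blast
    then show ?thesis using card_valleys_word[OF cs(1,2)] cs(3) v(3) by simp
  qed
  have ne: "refine_all bs \<noteq> []" using bs(2) refine_nonempty by (cases bs) auto
  have "word (refine_all bs) \<in> Dyck n"
    using assms(1) bs(3) by (simp add: word_Dyck_iff sum_list_refine_all nonneg_word_refine_all)
  moreover have "valleys w \<subseteq> valleys (word (refine_all bs))"
    using valleys_word_subset_iff[OF bs(1,2) positive_refine_all[OF bs(1)] ne]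
      partial_sums_refine_all[of bs] bs(3) by (simp add: sum_list_refine_all)
  moreover have "card (valleys (word (refine_all bs))) = min_sum bs - 1"
    using card_valleys_word[OF positive_refine_all[OF bs(1)] ne] length_refine_all[OF bs(1)]
    by simp
  ultimately have attained: "min_sum bs - 1 \<in> S"
    by (force simp: S_def Delta_Dyck_def)
  have "finite S" by (rule finite_subset[of _ "{..min_sum bs - 1}"]) (use upper in auto)
  then have "face_degree (Delta_Dyck n) (valleys w) = min_sum bs - 1"
    unfolding face_degree_def S_def[symmetric] using upper attained by (intro Max_eqI)
  \<comment> \<open>This makes the truncated \<open>min_sum bs - 1\<close> agree with the integer
    subtraction in \<open>mu\<close>.\<close>
  moreover have "1 \<le> min_sum bs" using bs(1,2) by (cases bs) auto
  ultimately show ?thesis using mu_word[OF bs(1,2)] bs(3) by simp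
qed

theorem theorem3p7:
  fixes n i j :: nat
  assumes "n \<ge> 1" and "j \<le> i" and "i \<le> n - 1"
  shows "f_triangle (Delta_Dyck n) i j =
    card {w \<in> Dyck n. card (valleys w) = j \<and> mu w = int i}"
proof -
  \<comment> \<open>Every face is the valley set of a path, whose \<open>mu\<close> is the degree of
    the face; injectivity of \<open>valleys\<close> then lets paths be counted instead of
    faces.\<close>
  have "{\<sigma> \<in> Delta_Dyck n. card \<sigma> = j \<and> face_degree (Delta_Dyck n) \<sigma> = i} =
    valleys ` {w \<in> Dyck n. card (valleys w) = j \<and> mu w = int i}"
    using assms(1) by (force simp: Delta_Dyck_def simp flip: face_degree_valleys)
  moreover have "inj_on valleys {w \<in> Dyck n. card (valleys w) = j \<and> mu w = int i}"
    using inj_on_valleys_Dyck[OF assms(1)] by (rule inj_on_subset) auto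
  ultimately show ?thesis by (simp add: f_triangle_def card_image)
qed

end
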